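(* Let $\alpha\in\mathbb{R}$, $\alpha>1$, and let $\{\lambda^{(n)}\}_{n\ge1}$ be a sequence of partitions, $\lambda^{(n)}\vdash n$, such that $\lambda^{(n)}_1\le\frac n\alpha$ and ${\lambda^{(n)}_1}'\le\frac n\alpha$ for all $n$. Then for every $\beta$ with $1<\beta<\alpha$ there exists $n_0$ such that $f^{\lambda^{(n)}}\ge\beta^n$ for all $n\ge n_0$.
   Context: For a partition $\lambda\vdash n$, $f^\lambda$ denotes the degree of the ordinary (characteristic zero) irreducible character of the symmetric group $S_n$ corresponding to $\lambda$ (the number of standard Young tableaux of shape $\lambda$). $\lambda'$ denotes the conjugate partition, so ${\lambda_1}'$ is the length of the first column (the number of nonzero parts) of $\lambda$. *)

theory Defs
  imports Complex_Main "HOL-Library.FuncSet"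
begin

definition is_partition :: "nat list \<Rightarrow> nat \<Rightarrow> bool"
  where "is_partition lam n \<longleftrightarrow>
    sorted_wrt (\<ge>) lam \<and> (\<forall>x \<in> set lam. 0 < x) \<and> sum_list lam = n"

definition conjugate :: "nat list \<Rightarrow> nat list"
  where "conjugate lam =
    (if lam = [] then [] else map (\<lambda>j. card {i. i < length lam \<and> j < lam ! i}) [0..<hd lam])"

text \<open>Cells are (row, column) pairs, both counted from 0.\<close>

definition young_diagram :: "nat list \<Rightarrow> (nat \<times> nat) set"
  where "young_diagram lam = {(i, j). i < length lam \<and> j < lam ! i}"

text \<open>Fillings are taken in the extensional function space, so that distinct tableaux are
  exactly distinct functions and the set is finite.\<close>

definition standard_tableaux :: "nat list \<Rightarrow> (nat \<times> nat \<Rightarrow> nat) set"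
  where "standard_tableaux lam =
    {T \<in> young_diagram lam \<rightarrow>\<^sub>E {1..sum_list lam}.
       bij_betw T (young_diagram lam) {1..sum_list lam} \<and>
       (\<forall>i j j'. (i, j) \<in> young_diagram lam \<and> (i, j') \<in> young_diagram lam \<and> j < j'
          \<longrightarrow> T (i, j) < T (i, j')) \<and>
       (\<forall>i i' j. (i, j) \<in> young_diagram lam \<and> (i', j) \<in> young_diagram lam \<and> i < i'
          \<longrightarrow> T (i, j) < T (i', j))}"

text \<open>The degree \<open>f\<^sup>\<lambda>\<close> of the ordinary irreducible character of the symmetric group
  labelled by \<open>\<lambda>\<close>, given as the number of standard Young tableaux of shape \<open>\<lambda>\<close>.\<close>

definition character_degree :: "nat list \<Rightarrow> nat"
  where "character_degree lam = card (standard_tableaux lam)"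

end

theory Submission
  imports Defs "HOL-Real_Asymp.Real_Asymp"
begin

text \<open>Let \<open>D\<close> be the diagram of \<open>\<lambda>\<close>, with \<open>n\<close> cells and Durfee square of side \<open>d\<close>, so that
  \<open>D\<close> is the square with \<open>d\<close> arms and \<open>d\<close> legs attached. Removing corners shows that \<open>f\<^sup>\<lambda>\<close> is at least any
  function on diagrams that is bounded by the sum of its values at the diagrams with one
  corner removed. Starting from the square, such a function is
  \<open>f(square) * N! * W(arms) * W(legs)\<close>, where \<open>N = n - d\<^sup>2\<close> and \<open>W\<close> is Frobenius'
  product \<open>\<Prod>\<^sub>i\<^sub><\<^sub>j (l\<^sub>i - l\<^sub>j) / \<Prod>\<^sub>i l\<^sub>i!\<close>; the required identity for \<open>W\<close> is a partial fraction expansion.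
  The shifted arm and leg lengths are at most \<open>n / \<alpha>\<close> and add up to \<open>n - d\<close>, so Stirling's bounds
  give \<open>f\<^sup>\<lambda> \<ge> \<alpha>\<^sup>n\<close> up to a factor whose logarithm is \<open>O(d ln n + d \<surd>n)\<close>. If \<open>d \<le> \<epsilon> \<surd>n\<close>,
  this loss is a small multiple of \<open>n\<close>; otherwise the \<open>d \<times> d\<close> square alone already has
  superexponentially many standard tableaux.\<close>

section \<open>Standard fillings of finite cell sets and removal of corners\<close>

text \<open>This is \<open>standard_tableaux\<close> for an arbitrary set of cells, so that removing
  a corner is plain set difference and no intermediate shape has to be written as a list.\<close>

definition increasing_fillings :: "(nat \<times> nat) set \<Rightarrow> (nat \<times> nat \<Rightarrow> nat) set" where
  "increasing_fillings D =
    {T \<in> D \<rightarrow>\<^sub>E {1..card D}. bij_betw T D {1..card D} \<and>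
       (\<forall>i j j'. (i, j) \<in> D \<and> (i, j') \<in> D \<and> j < j' \<longrightarrow> T (i, j) < T (i, j')) \<and>
       (\<forall>i i' j. (i, j) \<in> D \<and> (i', j) \<in> D \<and> i < i' \<longrightarrow> T (i, j) < T (i', j))}"

definition count_fillings :: "(nat \<times> nat) set \<Rightarrow> nat" where
  "count_fillings D = card (increasing_fillings D)"

definition corner :: "(nat \<times> nat) set \<Rightarrow> nat \<times> nat \<Rightarrow> bool" where
  "corner D c \<longleftrightarrow> c \<in> D \<and> (\<forall>i > fst c. (i, snd c) \<notin> D) \<and> (\<forall>j > snd c. (fst c, j) \<notin> D)"

lemma finite_increasing_fillings: "finite D \<Longrightarrow> finite (increasing_fillings D)"
  unfolding increasing_fillings_def
  by (rule finite_subset[of _ "D \<rightarrow>\<^sub>E {1..card D}"]) (auto intro: finite_PiE)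

lemma count_fillings_empty: "count_fillings {} = 1"
proof -
  have "increasing_fillings {} = {\<lambda>x. undefined}"
    by (auto simp: increasing_fillings_def bij_betw_def)
  then show ?thesis by (simp add: count_fillings_def)
qed

text \<open>No cell lies beyond a corner in its row or column, so the largest entry placed there
  breaks no inequality.\<close>

lemma extend_filling:
  assumes fin: "finite D" and c: "corner D c" and T: "T \<in> increasing_fillings (D - {c})"
  shows "T(c := card D) \<in> increasing_fillings D"
proof -
  let ?n = "card D"
  have cD: "c \<in> D" using c by (simp add: corner_def)
  have n: "card (D - {c}) = ?n - 1" "?n > 0" using fin cD by (auto simp: card_gt_0_iff)
  have rng: "T x \<in> {1..?n - 1}" if "x \<in> D" "x \<noteq> c" for x
  proof -
    have "T \<in> D - {c} \<rightarrow>\<^sub>E {1..?n - 1}" using T by (simp add: increasing_fillings_def n)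
    from PiE_mem[OF this, of x] that show ?thesis by simp
  qed
  have "bij_betw T (D - {c}) {1..?n - 1}" using T by (simp add: increasing_fillings_def n)
  then have "bij_betw (T(c := ?n)) (D - {c}) {1..?n - 1}"
    by (rule iffD1[OF bij_betw_cong, rotated]) auto
  then have "bij_betw (T(c := ?n)) ((D - {c}) \<union> {c}) ({1..?n - 1} \<union> {?n})"
    using n by (intro bij_betw_combine) (auto simp: bij_betw_def)
  moreover have "(D - {c}) \<union> {c} = D" "{1..?n - 1} \<union> {?n} = {1..?n}"
    using cD n by auto
  ultimately have bij: "bij_betw (T(c := ?n)) D {1..?n}" by simp
  have T1: "T (i, j) < T (i, j')" if "(i, j) \<in> D - {c}" "(i, j') \<in> D - {c}" "j < j'" for i j j'
    using T that unfolding increasing_fillings_def by blast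
  have T2: "T (i, j) < T (i', j)" if "(i, j) \<in> D - {c}" "(i', j) \<in> D - {c}" "i < i'" for i i' j
    using T that unfolding increasing_fillings_def by blast
  have lt: "T x < ?n" if "x \<in> D" "x \<noteq> c" for x using rng[OF that] n by auto
  have ext: "T(c := ?n) \<in> D \<rightarrow>\<^sub>E {1..?n}"
    using T cD bij by (auto simp: increasing_fillings_def PiE_iff extensional_def bij_betw_def)
  have r1: "(T(c := ?n)) (i, j) < (T(c := ?n)) (i, j')"
    if "(i, j) \<in> D" "(i, j') \<in> D" "j < j'" for i j j'
  proof -
    have "(i, j) \<noteq> c" using c that by (auto simp: corner_def)
    then show ?thesis using T1[of i j j'] lt[of "(i,j)"] that by auto
  qed
  have r2: "(T(c := ?n)) (i, j) < (T(c := ?n)) (i', j)"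
    if "(i, j) \<in> D" "(i', j) \<in> D" "i < i'" for i i' j
  proof -
    have "(i, j) \<noteq> c" using c that by (auto simp: corner_def)
    then show ?thesis using T2[of i j i'] lt[of "(i,j)"] that by auto
  qed
  show ?thesis unfolding increasing_fillings_def using ext bij r1 r2 by blast
qed

text \<open>Extending fillings of \<open>D - {c}\<close> by the entry \<open>card D\<close> at
  \<open>c\<close> is injective over all \<open>c\<close> together, since \<open>c\<close> can be
  read off as the only cell carrying \<open>card D\<close>.\<close>

lemma sum_corners_le_count_fillings:
  assumes fin: "finite D" and C: "\<And>c. c \<in> C \<Longrightarrow> corner D c"
  shows "(\<Sum>c\<in>C. count_fillings (D - {c})) \<le> count_fillings D"
proof -
  have CD: "C \<subseteq> D" using C by (auto simp: corner_def)
  then have finC: "finite C" using fin by (rule finite_subset)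
  define E where "E = (SIGMA c:C. increasing_fillings (D - {c}))"
  define h where "h = (\<lambda>(c, T :: nat \<times> nat \<Rightarrow> nat). T(c := card D))"
  have ne: "T x \<noteq> card D" if "T \<in> increasing_fillings (D - {c})" "x \<in> D" "x \<noteq> c" "c \<in> D" for T c x
  proof -
    have "T \<in> D - {c} \<rightarrow>\<^sub>E {1..card (D - {c})}" using that by (simp add: increasing_fillings_def)
    from PiE_mem[OF this, of x] that have "T x \<le> card (D - {c})" by simp
    also have "\<dots> < card D" using fin that by (meson card_Diff1_less)
    finally show ?thesis by simp
  qed
  have "inj_on h E"
  proof (rule inj_onI)
    fix p q assume p: "p \<in> E" and q: "q \<in> E" and eq: "h p = h q"
    obtain c T c' T' where pq: "p = (c, T)" "q = (c', T')" by fastforce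
    have T: "T \<in> increasing_fillings (D - {c})" "c \<in> D"
      and T': "T' \<in> increasing_fillings (D - {c'})" "c' \<in> D"
      using p q CD by (auto simp: pq E_def)
    have eq': "T(c := card D) = T'(c' := card D)" using eq by (simp add: h_def pq)
    have "c = c'"
    proof (rule ccontr)
      assume "c \<noteq> c'"
      then have "T' c = card D" using fun_cong[OF eq', of c] by simp
      then show False using ne[OF T'(1), of c] T T' \<open>c \<noteq> c'\<close> by auto
    qed
    moreover have "T x = T' x" for x
    proof (cases "x = c")
      case True
      \<comment> \<open>At \<open>c\<close> both functions are off their domain, where
        extensionality forces a common value.\<close>
      have "T \<in> D - {c} \<rightarrow>\<^sub>E {1..card (D - {c})}" "T' \<in> D - {c} \<rightarrow>\<^sub>E {1..card (D - {c})}"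
        using T T' \<open>c = c'\<close> by (simp_all add: increasing_fillings_def)
      from this[THEN PiE_arb, of c] show ?thesis using True by simp
    next
      case False
      then show ?thesis using fun_cong[OF eq', of x] \<open>c = c'\<close> by simp
    qed
    ultimately show "p = q" by (auto simp: pq)
  qed
  moreover have "h ` E \<subseteq> increasing_fillings D"
    using extend_filling[OF fin C] by (auto simp: h_def E_def)
  ultimately have "card E \<le> card (increasing_fillings D)"
    by (rule card_inj_on_le) (rule finite_increasing_fillings[OF fin])
  moreover have "card E = (\<Sum>c\<in>C. card (increasing_fillings (D - {c})))"
    unfolding E_def using fin finC by (intro card_SigmaI) (auto intro: finite_increasing_fillings)
  ultimately show ?thesis by (simp add: count_fillings_def)
qed

definition down_set :: "(nat \<times> nat) set \<Rightarrow> bool" where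
  "down_set D \<longleftrightarrow> (\<forall>i j i' j'. (i, j) \<in> D \<longrightarrow> i' \<le> i \<longrightarrow> j' \<le> j \<longrightarrow> (i', j') \<in> D)"

text \<open>The cells of \<open>D - E\<close> are removed one at a time, each a corner of the
  current set.\<close>

lemma count_fillings_mono:
  assumes "finite D" "down_set E" "E \<subseteq> D"
  shows "count_fillings E \<le> count_fillings D"
  using assms
proof (induction "card (D - E)" arbitrary: D)
  case 0
  then have "D = E" by auto
  then show ?case by simp
next
  case (Suc m)
  have fin: "finite (D - E)" using Suc by simp
  have ne: "D - E \<noteq> {}" using Suc(2) by (metis card.empty Zero_not_Suc)
  \<comment> \<open>A cell of \<open>D - E\<close> with the largest coordinate sum is a corner of
    \<open>D\<close>: a cell of \<open>D\<close> beyond it in its row or column would lie in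
    \<open>E\<close>, and the down-set \<open>E\<close> would then contain the chosen cell
    too.\<close>
  define h where "h = (\<lambda>c :: nat \<times> nat. fst c + snd c)"
  have "Max (h ` (D - E)) \<in> h ` (D - E)" using fin ne by simp
  then obtain c where c: "c \<in> D - E" and hc: "h c = Max (h ` (D - E))" by fastforce
  have mx: "fst x + snd x \<le> fst c + snd c" if "x \<in> D - E" for x
  proof -
    have "h x \<le> h c" unfolding hc using fin that by (intro Max_ge) auto
    then show ?thesis by (simp add: h_def)
  qed
  have "corner D c"
    unfolding corner_def
  proof (intro conjI allI impI notI)
    show "c \<in> D" using c by simp
  next
    fix i assume i: "fst c < i" "(i, snd c) \<in> D"
    then have "(i, snd c) \<in> E" using mx[of "(i, snd c)"] by auto
    then have "(fst c, snd c) \<in> E" using Suc(4) i by (meson down_set_def less_imp_le order_refl)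
    then show False using c by simp
  next
    fix j assume j: "snd c < j" "(fst c, j) \<in> D"
    then have "(fst c, j) \<in> E" using mx[of "(fst c, j)"] by auto
    then have "(fst c, snd c) \<in> E" using Suc(4) j by (meson down_set_def less_imp_le order_refl)
    then show False using c by simp
  qed
  then have le: "count_fillings (D - {c}) \<le> count_fillings D"
    using sum_corners_le_count_fillings[of D "{c}"] Suc by simp
  have "D - {c} - E = (D - E) - {c}" by auto
  then have "m = card (D - {c} - E)" using Suc(2) c fin by (simp add: card_Diff_singleton)
  from Suc(1)[OF this] Suc(3-5) c have "count_fillings E \<le> count_fillings (D - {c})" by auto
  with le show ?case by simp
qed

section \<open>Partial fractions and Frobenius' product\<close>

text \<open>Up to sign, \<open>c I i\<close> is the residue at \<open>z = x i\<close> of the product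
  over \<open>j\<close>. The two sums are what comparing coefficients of \<open>1 / z\<close> and
  \<open>1 / z^2\<close> at infinity would give; a joint induction on \<open>I\<close> replaces the
  limits. The last identity drives the recursion for \<open>row_weight\<close>.\<close>

lemma partial_fraction_coeffs:
  fixes x :: "'a \<Rightarrow> real"
  defines "c \<equiv> \<lambda>I i. \<Prod>j\<in>I - {i}. 1 - 1 / (x i - x j)"
  assumes "finite I" "inj_on x I"
  shows "(\<forall>z. z \<notin> x ` I \<longrightarrow> (\<Prod>j\<in>I. 1 - 1 / (z - x j)) = 1 - (\<Sum>i\<in>I. c I i / (z - x i))) \<and>
    (\<Sum>i\<in>I. c I i) = card I \<and>
    (\<Sum>i\<in>I. x i * c I i) = (\<Sum>i\<in>I. x i) - real (card I) * (real (card I) - 1) / 2"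
  using assms(2,3)
proof (induction I rule: finite_induct)
  case empty
  then show ?case by simp
next
  case (insert k I)
  let ?y = "x k"
  have inj: "inj_on x I" and yI: "?y \<notin> x ` I" using insert by auto
  have IH1: "(\<Prod>j\<in>I. 1 - 1 / (z - x j)) = 1 - (\<Sum>i\<in>I. c I i / (z - x i))" if "z \<notin> x ` I" for z
    using insert.IH[OF inj] that by blast
  have IH2: "(\<Sum>i\<in>I. c I i) = card I" using insert.IH[OF inj] by blast
  have IH3: "(\<Sum>i\<in>I. x i * c I i) = (\<Sum>i\<in>I. x i) - real (card I) * (real (card I) - 1) / 2"
    using insert.IH[OF inj] by blast
  have cI: "c (insert k I) i = c I i * (1 - 1 / (x i - ?y))" if "i \<in> I" for i
  proof -
    have "insert k I - {i} = insert k (I - {i})" using that insert by auto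
    then show ?thesis using insert unfolding c_def by (simp add: mult.commute)
  qed
  \<comment> \<open>The new coefficient is the old product evaluated at \<open>z = x k\<close>, so
    the first identity for \<open>I\<close> expands it.\<close>
  have ck: "c (insert k I) k = 1 - (\<Sum>i\<in>I. c I i / (?y - x i))"
  proof -
    have "insert k I - {k} = I" using insert by auto
    then show ?thesis using IH1[OF yI] unfolding c_def by simp
  qed
  have ne: "x i - ?y \<noteq> 0" "?y - x i \<noteq> 0" if "i \<in> I" for i
    using yI that by (metis eq_iff_diff_eq_0 imageI)+
  have 1: "(\<Prod>j\<in>insert k I. 1 - 1 / (z - x j)) = 1 - (\<Sum>i\<in>insert k I. c (insert k I) i / (z - x i))"
    if z: "z \<notin> x ` insert k I" for z
  proof -
    have zy: "z - ?y \<noteq> 0" and zi: "\<And>i. i \<in> I \<Longrightarrow> z - x i \<noteq> 0" using z by auto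
    \<comment> \<open>Distributing the expanded coefficient of \<open>k\<close> over the terms of
      \<open>I\<close> reduces the identity to one for each \<open>i\<close>.\<close>
    have t: "c (insert k I) i / (z - x i) - c I i / (?y - x i) / (z - ?y)
        = c I i / (z - x i) * (1 - 1 / (z - ?y))" if "i \<in> I" for i
    proof -
      have "(1 - 1 / (x i - ?y)) / (z - x i) - 1 / (?y - x i) / (z - ?y)
          = 1 / (z - x i) * (1 - 1 / (z - ?y))"
        using ne[OF that] zi[OF that] zy by (simp add: divide_simps) (simp add: algebra_simps)
      moreover have "C * q / w - C / u / v = C * (q / w - 1 / u / v)"
        and "C * (1 / w * q) = C / w * q" for C q w u v :: real
        by (simp_all add: right_diff_distrib)
      ultimately show ?thesis unfolding cI[OF that] by metis
    qed
    have "(\<Sum>i\<in>insert k I. c (insert k I) i / (z - x i))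
        = (\<Sum>i\<in>I. c (insert k I) i / (z - x i)) + (1 - (\<Sum>i\<in>I. c I i / (?y - x i))) / (z - ?y)"
      using insert by (simp add: ck)
    also have "\<dots> = (\<Sum>i\<in>I. c (insert k I) i / (z - x i) - c I i / (?y - x i) / (z - ?y)) + 1 / (z - ?y)"
      by (simp add: sum_subtractf diff_divide_distrib sum_divide_distrib)
    also have "\<dots> = (\<Sum>i\<in>I. c I i / (z - x i)) * (1 - 1 / (z - ?y)) + 1 / (z - ?y)"
      unfolding sum_distrib_right by (intro arg_cong2[of _ _ _ _ "(+)"] sum.cong refl t)
    finally have e: "1 - (\<Sum>i\<in>insert k I. c (insert k I) i / (z - x i))
        = (1 - (\<Sum>i\<in>I. c I i / (z - x i))) * (1 - 1 / (z - ?y))"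
      by (simp add: algebra_simps)
    have "z \<notin> x ` I" using z by auto
    from e IH1[OF this] show ?thesis using insert by (simp add: mult.commute)
  qed
  have 2: "(\<Sum>i\<in>insert k I. c (insert k I) i) = card (insert k I)"
  proof -
    have "(\<Sum>i\<in>insert k I. c (insert k I) i)
       = 1 + (\<Sum>i\<in>I. c (insert k I) i - c I i / (?y - x i))"
      using insert by (simp add: ck sum_subtractf)
    also have "(\<Sum>i\<in>I. c (insert k I) i - c I i / (?y - x i)) = (\<Sum>i\<in>I. c I i)"
      using ne by (intro sum.cong refl) (simp add: cI divide_simps, simp add: algebra_simps)
    finally show ?thesis using insert IH2 by simp
  qed
  have 3: "(\<Sum>i\<in>insert k I. x i * c (insert k I) i)
      = (\<Sum>i\<in>insert k I. x i) - real (card (insert k I)) * (real (card (insert k I)) - 1) / 2"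
  proof -
    have "(\<Sum>i\<in>insert k I. x i * c (insert k I) i)
       = ?y + (\<Sum>i\<in>I. x i * c (insert k I) i - ?y * (c I i / (?y - x i)))"
      using insert by (simp add: ck sum_subtractf sum_distrib_left right_diff_distrib)
    also have "(\<Sum>i\<in>I. x i * c (insert k I) i - ?y * (c I i / (?y - x i)))
        = (\<Sum>i\<in>I. x i * c I i - c I i)"
      using ne by (intro sum.cong refl) (simp add: cI divide_simps, simp add: algebra_simps)
    finally show ?thesis using insert IH2 IH3 by (simp add: sum_subtractf field_simps)
  qed
  show ?case using 1 2 3 by blast
qed

definition vandermonde :: "nat \<Rightarrow> (nat \<Rightarrow> real) \<Rightarrow> real" where
  "vandermonde d x = (\<Prod>j<d. \<Prod>i<j. x i - x j)"

lemma vandermonde_Suc: "vandermonde (Suc d) x = vandermonde d x * (\<Prod>i<d. x i - x d)"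
  by (simp add: vandermonde_def)

text \<open>Every factor containing \<open>x k\<close> is scaled by
  \<open>1 - 1 / (x k - x j)\<close>, whether \<open>k\<close> is the earlier or the later index:
  \<open>x j - (x k - 1) = (x j - x k) * (1 - 1 / (x k - x j))\<close>.\<close>

lemma vandermonde_decrement:
  assumes "inj_on x {..<d}" "k < d"
  shows "vandermonde d (x(k := x k - 1)) = vandermonde d x * (\<Prod>j\<in>{..<d} - {k}. 1 - 1 / (x k - x j))"
  using assms
proof (induction d)
  case 0
  then show ?case by simp
next
  case (Suc d)
  have inj: "inj_on x {..<d}" using Suc by (meson inj_on_subset lessThan_subset_iff less_imp_le lessI)
  have ne: "x i \<noteq> x d" if "i < d" for i using Suc(2) that by (auto simp: inj_on_def)
  show ?case
  proof (cases "k = d")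
    case True
    have v: "vandermonde d (x(k := x k - 1)) = vandermonde d x"
      unfolding vandermonde_def using True by (intro prod.cong refl) auto
    have p: "(\<Prod>i<d. (x(k := x k - 1)) i - (x(k := x k - 1)) d)
        = (\<Prod>i<d. (x i - x d) * (1 - 1 / (x d - x i)))"
    proof (intro prod.cong refl)
      fix i assume "i \<in> {..<d}"
      then have "x d - x i \<noteq> 0" "i \<noteq> k" using ne[of i] True by auto
      then have "x i - (x d - 1) = (x i - x d) * (1 - 1 / (x d - x i))"
        by (simp add: field_simps)
      then show "(x(k := x k - 1)) i - (x(k := x k - 1)) d = (x i - x d) * (1 - 1 / (x d - x i))"
        using True \<open>i \<noteq> k\<close> by simp
    qed
    have "{..<Suc d} - {k} = {..<d}" using True by auto
    then show ?thesis unfolding vandermonde_Suc v p prod.distrib using True by simp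
  next
    case False
    then have k: "k < d" using Suc by simp
    have "{..<d} = insert k ({..<d} - {k})" using k by auto
    then have sp: "(\<Prod>i<d. h i) = h k * (\<Prod>i\<in>{..<d} - {k}. h i)" for h :: "nat \<Rightarrow> real"
      by (metis finite_lessThan prod.remove k lessThan_iff)
    have "(\<Prod>i<d. (x(k := x k - 1)) i - (x(k := x k - 1)) d)
       = (x k - 1 - x d) * (\<Prod>i\<in>{..<d} - {k}. x i - x d)"
      using k by (subst sp) (auto intro!: prod.cong)
    also have "\<dots> = (x k - x d) * (1 - 1 / (x k - x d)) * (\<Prod>i\<in>{..<d} - {k}. x i - x d)"
      using ne[OF k] by (simp add: field_simps)
    also have "\<dots> = (1 - 1 / (x k - x d)) * (\<Prod>i<d. x i - x d)"
      by (subst sp) simp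
    finally have e: "(\<Prod>i<d. (x(k := x k - 1)) i - (x(k := x k - 1)) d)
       = (1 - 1 / (x k - x d)) * (\<Prod>i<d. x i - x d)" .
    have "{..<Suc d} - {k} = insert d ({..<d} - {k})" using k by auto
    then have "(\<Prod>j\<in>{..<Suc d} - {k}. 1 - 1 / (x k - x j))
       = (1 - 1 / (x k - x d)) * (\<Prod>j\<in>{..<d} - {k}. 1 - 1 / (x k - x j))" by simp
    then show ?thesis unfolding vandermonde_Suc e Suc.IH[OF inj k] by (simp only: mult_ac)
  qed
qed

text \<open>Frobenius' formula: for weakly decreasing \<open>r\<close>, this times the factorial of
  the sum of the row lengths is the number of standard tableaux with rows
  \<open>r 0, ..., r (d - 1)\<close>.\<close>

definition row_weight :: "nat \<Rightarrow> (nat \<Rightarrow> nat) \<Rightarrow> real" where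
  "row_weight d r =
    vandermonde d (\<lambda>i. real (r i + (d - Suc i))) / (\<Prod>i<d. fact (r i + (d - Suc i)))"

definition removable :: "nat \<Rightarrow> (nat \<Rightarrow> nat) \<Rightarrow> nat set" where
  "removable d r = {i. i < d \<and> 0 < r i \<and> (\<forall>k. i < k \<and> k < d \<longrightarrow> r k < r i)}"

text \<open>The staircase offset turns weak into strict decrease, so the denominators in the partial
  fractions do not vanish.\<close>

lemma antimono_on_offset_less:
  assumes "antimono_on {..<d} r" "i < j" "j < d"
  shows "r j + (d - Suc j) < r i + (d - Suc i)"
proof -
  have "r j \<le> r i" using assms by (auto simp: monotone_on_def)
  then show ?thesis using assms by linarith
qed

lemma sum_lessThan_offset: "(\<Sum>i<d. real (d - Suc i)) = real d * (real d - 1) / 2"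
proof -
  have "(\<Sum>i<d. real (d - Suc i)) = (\<Sum>i<d. real i)"
    by (rule sum.nat_diff_reindex)
  also have "\<dots> = real d * (real d - 1) / 2"
    by (induction d) (auto simp: field_simps)
  finally show ?thesis .
qed

text \<open>Shortening row \<open>i\<close> multiplies the weight by \<open>x i * c i\<close>: the
  factor \<open>c i\<close> comes from the Vandermonde product, \<open>x i\<close> from the
  factorial. Rows that cannot be shortened contribute zero, so the sum extends to all
  \<open>i < d\<close> and the last partial fraction identity evaluates it; the offsets cancel the
  term \<open>d * (d - 1) / 2\<close>.\<close>

lemma sum_row_weight_removable:
  assumes anti: "antimono_on {..<d} r"
  shows "(\<Sum>i\<in>removable d r. row_weight d (r(i := r i - 1))) = real (\<Sum>i<d. r i) * row_weight d r"
proof -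
  define x where "x i = real (r i + (d - Suc i))" for i
  define c where "c i = (\<Prod>j\<in>{..<d} - {i}. 1 - 1 / (x i - x j))" for i
  have "x j < x i" if "i < j" "j < d" for i j
    using antimono_on_offset_less[OF anti that] by (simp add: x_def del: of_nat_add)
  then have inj: "inj_on x {..<d}"
    by (intro linorder_inj_onI) force+
  have upd: "row_weight d (r(i := r i - 1)) = row_weight d r * (x i * c i)" if "i \<in> removable d r" for i
  proof -
    have i: "i < d" "0 < r i" using that by (auto simp: removable_def)
    have "(\<lambda>k. real ((r(i := r i - 1)) k + (d - Suc k))) = x(i := x i - 1)"
      using i by (auto simp: x_def fun_eq_iff)
    then have v: "vandermonde d (\<lambda>k. real ((r(i := r i - 1)) k + (d - Suc k))) = vandermonde d x * c i"
      using vandermonde_decrement[OF inj i(1)] by (simp add: c_def)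
    have "(\<Prod>k<d. fact (r k + (d - Suc k)) :: real)
        = fact (r i + (d - Suc i)) * (\<Prod>k\<in>{..<d} - {i}. fact (r k + (d - Suc k)))"
      using i by (intro prod.remove) auto
    also have "fact (r i + (d - Suc i)) = (x i * fact (r i - 1 + (d - Suc i)) :: real)"
      using i by (subst fact_reduce) (auto simp: x_def)
    also have "x i * fact (r i - 1 + (d - Suc i)) * (\<Prod>k\<in>{..<d} - {i}. fact (r k + (d - Suc k)) :: real)
        = x i * (\<Prod>k<d. fact ((r(i := r i - 1)) k + (d - Suc k)))"
      using i by (subst (2) prod.remove[of _ i]) auto
    finally have P: "(\<Prod>k<d. fact (r k + (d - Suc k)) :: real) =
       x i * (\<Prod>k<d. fact ((r(i := r i - 1)) k + (d - Suc k)))" .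
    have X: "(\<lambda>k. real (r k + (d - Suc k))) = x" by (simp add: x_def fun_eq_iff)
    have "x i \<noteq> 0" using i by (simp add: x_def)
    then show ?thesis unfolding row_weight_def v P X by simp
  qed
  \<comment> \<open>If shortening row \<open>i\<close> is not allowed, then it would make \<open>x i\<close> collide with \<open>x (Suc i)\<close>,
    or it is the last row and \<open>x i = 0\<close>.\<close>
  have zero: "x i * c i = 0" if i: "i < d" "i \<notin> removable d r" for i
  proof (cases "Suc i < d")
    case True
    have "\<exists>k. i < k \<and> k < d \<and> r i \<le> r k \<or> r i = 0" using i by (auto simp: removable_def not_less)
    moreover have "r (Suc i) \<le> r i" using anti True by (auto simp: monotone_on_def)
    moreover have "r k \<le> r (Suc i)" if "i < k" "k < d" for k
      using anti True that by (auto simp: monotone_on_def)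
    ultimately have "r (Suc i) = r i" by fastforce
    then have "x i - x (Suc i) = 1" using True by (simp add: x_def)
    then have "c i = 0" unfolding c_def using True by (intro prod_zero bexI[of _ "Suc i"]) auto
    then show ?thesis by simp
  next
    case False
    then have "r i = 0" "d = Suc i" using i by (auto simp: removable_def)
    then show ?thesis by (simp add: x_def)
  qed
  have "(\<Sum>i\<in>removable d r. row_weight d (r(i := r i - 1))) = (\<Sum>i\<in>removable d r. row_weight d r * (x i * c i))"
    by (intro sum.cong refl upd)
  also have "\<dots> = (\<Sum>i<d. row_weight d r * (x i * c i))"
    using zero by (intro sum.mono_neutral_left) (auto simp: removable_def)
  also have "\<dots> = row_weight d r * ((\<Sum>i<d. x i) - real d * (real d - 1) / 2)"
    using partial_fraction_coeffs[OF finite_lessThan inj] by (simp add: sum_distrib_left[symmetric] c_def)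
  also have "(\<Sum>i<d. x i) = real (\<Sum>i<d. r i) + real d * (real d - 1) / 2"
    by (simp only: x_def of_nat_add sum.distrib sum_lessThan_offset of_nat_sum)
  also have "row_weight d r * (real (\<Sum>i<d. r i) + real d * (real d - 1) / 2 - real d * (real d - 1) / 2)
      = real (\<Sum>i<d. r i) * row_weight d r"
    by simp
  finally show ?thesis .
qed

section \<open>Arms and legs attached to a rectangle\<close>

text \<open>The case \<open>d = e\<close> serves the Durfee square; independent sides also allow
  \<open>e = 0\<close>, where the arms alone form an ordinary diagram.\<close>

definition arms_legs :: "nat \<Rightarrow> nat \<Rightarrow> (nat \<Rightarrow> nat) \<Rightarrow> (nat \<Rightarrow> nat) \<Rightarrow> (nat \<times> nat) set" where
  "arms_legs d e r s = {(i, j). i < d \<and> j < e + r i} \<union> {(i, j). j < e \<and> i < d + s j}"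

lemma finite_arms_legs: "finite (arms_legs d e r s)"
proof -
  have "arms_legs d e r s \<subseteq> (SIGMA i:{..<d}. {..<e + r i}) \<union> (\<lambda>(j, i). (i, j)) ` (SIGMA j:{..<e}. {..<d + s j})"
    by (auto simp: arms_legs_def image_iff)
  then show ?thesis by (rule finite_subset) auto
qed

text \<open>A nonempty arm ends in a column at least \<open>e\<close>, where there are no legs, so
  only the other arms decide whether its end is a corner.\<close>

lemma arms_legs_remove_arm:
  assumes "i \<in> removable d r"
  shows "corner (arms_legs d e r s) (i, e + r i - 1)"
    and "arms_legs d e r s - {(i, e + r i - 1)} = arms_legs d e (r(i := r i - 1)) s"
proof -
  have "i < d" "0 < r i" "\<And>k. i < k \<Longrightarrow> k < d \<Longrightarrow> r k < r i" using assms by (auto simp: removable_def)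
  then show "corner (arms_legs d e r s) (i, e + r i - 1)"
    by (fastforce simp: corner_def arms_legs_def)
  show "arms_legs d e r s - {(i, e + r i - 1)} = arms_legs d e (r(i := r i - 1)) s"
    using \<open>i < d\<close> \<open>0 < r i\<close> by (auto simp: arms_legs_def split: if_splits)
qed

lemma arms_legs_remove_leg:
  assumes "j \<in> removable e s"
  shows "corner (arms_legs d e r s) (d + s j - 1, j)"
    and "arms_legs d e r s - {(d + s j - 1, j)} = arms_legs d e r (s(j := s j - 1))"
proof -
  have "j < e" "0 < s j" "\<And>k. j < k \<Longrightarrow> k < e \<Longrightarrow> s k < s j" using assms by (auto simp: removable_def)
  then show "corner (arms_legs d e r s) (d + s j - 1, j)"
    by (fastforce simp: corner_def arms_legs_def)
  show "arms_legs d e r s - {(d + s j - 1, j)} = arms_legs d e r (s(j := s j - 1))"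
    using \<open>j < e\<close> \<open>0 < s j\<close> by (auto simp: arms_legs_def split: if_splits)
qed

lemma antimono_on_remove:
  assumes "antimono_on {..<d} r" "i \<in> removable d r"
  shows "antimono_on {..<d} (r(i := r i - 1))"
  unfolding monotone_on_def
proof (intro ballI impI)
  fix j k assume jk: "j \<in> {..<d}" "k \<in> {..<d}" "j \<le> k"
  have "r k \<le> r j" using assms jk by (auto simp: monotone_on_def)
  moreover have "r k < r i" if "i < k" using assms jk that by (auto simp: removable_def)
  ultimately show "(r(i := r i - 1)) k \<le> (r(i := r i - 1)) j"
    using jk by (cases "j = i"; cases "k = i") auto
qed

lemma sum_decrement:
  fixes r :: "nat \<Rightarrow> nat"
  assumes "i \<in> removable d r"
  shows "Suc (\<Sum>k<d. (r(i := r i - 1)) k) = (\<Sum>k<d. r k)"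
proof -
  have i: "i < d" "0 < r i" using assms by (auto simp: removable_def)
  have "(\<Sum>k<d. r k) = r i + (\<Sum>k\<in>{..<d} - {i}. r k)" using i by (intro sum.remove) auto
  moreover have "(\<Sum>k<d. (r(i := r i - 1)) k) = r i - 1 + (\<Sum>k\<in>{..<d} - {i}. r k)"
    using i by (subst sum.remove[of _ i]) auto
  ultimately show ?thesis using i by simp
qed

lemma vandermonde_offset: "vandermonde d (\<lambda>i. real (d - Suc i)) = (\<Prod>j<d. fact j)"
proof -
  have row: "(\<Prod>i<j. real (j - i)) = fact j" for j
  proof -
    have "(\<Prod>i<j. real (j - i)) = (\<Prod>i<j. real (Suc (j - Suc i)))"
      by (intro prod.cong refl) (auto simp: Suc_diff_Suc simp del: of_nat_Suc)
    also have "\<dots> = (\<Prod>i<j. real (Suc i))"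
      by (rule prod.nat_diff_reindex)
    also have "\<dots> = fact j" by (simp add: fact_prod_Suc atLeast0LessThan)
    finally show ?thesis .
  qed
  have "vandermonde d (\<lambda>i. real (d - Suc i)) = (\<Prod>j<d. \<Prod>i<j. real (j - i))"
    unfolding vandermonde_def by (intro prod.cong refl) (auto simp: of_nat_diff)
  then show ?thesis unfolding row .
qed

lemma row_weight_zero:
  assumes "\<And>i. i < d \<Longrightarrow> r i = 0"
  shows "row_weight d r = 1"
proof -
  have "vandermonde d (\<lambda>i. real (r i + (d - Suc i))) = vandermonde d (\<lambda>i. real (d - Suc i))"
    unfolding vandermonde_def using assms by (intro prod.cong refl) auto
  moreover have "(\<Prod>i<d. fact (r i + (d - Suc i)) :: real) = (\<Prod>i<d. fact (d - Suc i))"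
    using assms by (intro prod.cong refl) auto
  moreover have "\<dots> = (\<Prod>i<d. fact i)" by (rule prod.nat_diff_reindex)
  ultimately show ?thesis by (simp add: row_weight_def vandermonde_offset)
qed

text \<open>By Frobenius' formula the left side counts the fillings that put the smallest entries on
  the rectangle and then interleave a tableau on the arms with one on the legs. The proof is by
  induction on the number of arm and leg cells: the left side is the sum of its values after
  removing one removable arm end or leg end, and these ends are corners.\<close>

lemma count_fillings_arms_legs:
  assumes "antimono_on {..<d} r" "antimono_on {..<e} s"
  shows "real (count_fillings ({..<d} \<times> {..<e})) * fact ((\<Sum>i<d. r i) + (\<Sum>j<e. s j))
      * row_weight d r * row_weight e s \<le> real (count_fillings (arms_legs d e r s))"
  using assms
proof (induction "(\<Sum>i<d. r i) + (\<Sum>j<e. s j)" arbitrary: r s)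
  case 0
  then have z: "\<And>i. i < d \<Longrightarrow> r i = 0" "\<And>j. j < e \<Longrightarrow> s j = 0" by auto
  then have "arms_legs d e r s = {..<d} \<times> {..<e}" by (auto simp: arms_legs_def)
  then show ?case using 0 z by (simp add: row_weight_zero)
next
  case (Suc m)
  define F where "F = real (count_fillings ({..<d} \<times> {..<e}))"
  let ?D = "arms_legs d e r s"
  let ?A = "(\<lambda>i. (i, e + r i - 1)) ` removable d r"
  let ?L = "(\<lambda>j. (d + s j - 1, j)) ` removable e s"
  have fin: "finite (removable d r)" "finite (removable e s)" by (auto simp: removable_def)
  \<comment> \<open>Arm ends lie in columns at least \<open>e\<close>, leg ends in columns below
    \<open>e\<close>, so no corner is counted twice.\<close>
  have disj: "?A \<inter> ?L = {}" by (auto simp: removable_def)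
  have arm: "F * fact m * row_weight d (r(i := r i - 1)) * row_weight e s
      \<le> real (count_fillings (?D - {(i, e + r i - 1)}))" if "i \<in> removable d r" for i
  proof -
    have "m = (\<Sum>k<d. (r(i := r i - 1)) k) + (\<Sum>j<e. s j)"
      using sum_decrement[OF that] Suc(2) by simp
    from Suc(1)[OF this antimono_on_remove[OF Suc(3) that] Suc(4)] this show ?thesis
      unfolding arms_legs_remove_arm(2)[OF that] F_def by simp
  qed
  have leg: "F * fact m * row_weight d r * row_weight e (s(j := s j - 1))
      \<le> real (count_fillings (?D - {(d + s j - 1, j)}))" if "j \<in> removable e s" for j
  proof -
    have "m = (\<Sum>i<d. r i) + (\<Sum>k<e. (s(j := s j - 1)) k)"
      using sum_decrement[OF that] Suc(2) by simp
    from Suc(1)[OF this Suc(3) antimono_on_remove[OF Suc(4) that]] this show ?thesis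
      unfolding arms_legs_remove_leg(2)[OF that] F_def by simp
  qed
  have "F * fact (Suc m) * row_weight d r * row_weight e s
     = F * fact m * (real (\<Sum>i<d. r i) * row_weight d r) * row_weight e s
       + F * fact m * row_weight d r * (real (\<Sum>j<e. s j) * row_weight e s)"
    using arg_cong[OF Suc(2), of real] by (simp add: fact_Suc algebra_simps)
  also have "\<dots> = (\<Sum>i\<in>removable d r. F * fact m * row_weight d (r(i := r i - 1)) * row_weight e s)
       + (\<Sum>j\<in>removable e s. F * fact m * row_weight d r * row_weight e (s(j := s j - 1)))"
    unfolding sum_row_weight_removable[OF Suc(3), symmetric] sum_row_weight_removable[OF Suc(4), symmetric]
    by (simp add: sum_distrib_left sum_distrib_right)
  also have "\<dots> \<le> (\<Sum>i\<in>removable d r. real (count_fillings (?D - {(i, e + r i - 1)})))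
       + (\<Sum>j\<in>removable e s. real (count_fillings (?D - {(d + s j - 1, j)})))"
    using arm leg by (intro add_mono sum_mono) auto
  also have "\<dots> = (\<Sum>c\<in>?A. real (count_fillings (?D - {c}))) + (\<Sum>c\<in>?L. real (count_fillings (?D - {c})))"
    by (subst (1 2) sum.reindex) (auto simp: inj_on_def)
  also have "\<dots> = real (\<Sum>c\<in>?A \<union> ?L. count_fillings (?D - {c}))"
    using fin disj by (subst sum.union_disjoint) auto
  also have "\<dots> \<le> real (count_fillings ?D)"
    using arms_legs_remove_arm(1) arms_legs_remove_leg(1)
    by (intro of_nat_mono sum_corners_le_count_fillings finite_arms_legs) auto
  finally show ?case using Suc(2) by (simp add: F_def)
qed

section \<open>Factorial estimates and the square\<close>

lemma fact_ge_pow: "(real n / exp 1) ^ n \<le> fact n"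
proof (induction n)
  case (Suc n)
  show ?case
  proof (cases "n = 0")
    case False
    have "1 + 1 / real n \<le> exp (1 / real n)" by (rule exp_ge_add_one_self)
    then have "(1 + 1 / real n) ^ n \<le> exp (1 / real n) ^ n" by (intro power_mono) auto
    also have "\<dots> = exp 1" using False by (simp add: exp_of_nat_mult[symmetric])
    finally have e: "(1 + 1 / real n) ^ n \<le> exp 1" .
    have "real (Suc n) / exp 1 = (1 + 1 / real n) * (real n / exp 1)" using False by (simp add: field_simps)
    then have "(real (Suc n) / exp 1) ^ Suc n
        = (1 + 1 / real n) ^ n * (real n / exp 1) ^ n * (real (Suc n) / exp 1)"
      by (simp only: power_Suc2 power_mult_distrib)
    also have "\<dots> \<le> exp 1 * fact n * (real (Suc n) / exp 1)"
      using e Suc by (intro mult_right_mono mult_mono) auto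
    also have "\<dots> = fact (Suc n)" by simp
    finally show ?thesis .
  qed simp
qed simp

text \<open>The induction step rests on \<open>(1 - 1 / Suc n) ^ Suc n \<le> exp (-1)\<close>, as
  that of the lower bound rests on \<open>(1 + 1 / n) ^ n \<le> exp 1\<close>.\<close>

lemma fact_le_pow:
  assumes "1 \<le> n"
  shows "fact n \<le> exp 1 * real n * (real n / exp 1) ^ n"
  using assms
proof (induction n rule: dec_induct)
  case base
  show ?case by simp
next
  case (step n)
  have "1 + - (1 / real (Suc n)) \<le> exp (- (1 / real (Suc n)))" by (rule exp_ge_add_one_self)
  then have "(1 - 1 / real (Suc n)) ^ Suc n \<le> exp (- (1 / real (Suc n))) ^ Suc n"
    by (intro power_mono) auto
  also have "\<dots> = exp (-1)" unfolding exp_of_nat_mult[symmetric] by simp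
  finally have "(1 - 1 / real (Suc n)) ^ Suc n \<le> exp (-1)" .
  moreover have "1 - 1 / real (Suc n) = real n / real (Suc n)" by (simp add: field_simps)
  ultimately have e: "(real n / real (Suc n)) ^ Suc n * exp 1 \<le> 1"
    by (simp add: exp_minus field_simps del: of_nat_Suc)
  have "fact (Suc n) = real (Suc n) * fact n" by simp
  also have "\<dots> \<le> real (Suc n) * (exp 1 * real n * (real n / exp 1) ^ n)"
    using step by (intro mult_left_mono) auto
  also have "\<dots> = real (Suc n) * exp 1 * exp 1 * (real n / exp 1) ^ Suc n" by simp
  also have "\<dots> = exp 1 * real (Suc n) * (real (Suc n) / exp 1) ^ Suc n
       * ((real n / real (Suc n)) ^ Suc n * exp 1)"
    by (simp add: power_divide del: of_nat_Suc power_Suc)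
  also have "\<dots> \<le> exp 1 * real (Suc n) * (real (Suc n) / exp 1) ^ Suc n * 1"
    by (intro mult_left_mono e) auto
  finally show ?case by simp
qed

text \<open>A common base \<open>M\<close> makes a product of such bounds depend only on the number
  of factors and the sum of the exponents.\<close>

lemma fact_le_pow_of_le:
  assumes "real k \<le> M" "k \<le> n" "1 \<le> n"
  shows "fact k \<le> exp 1 * real n * (M / exp 1) ^ k"
proof (cases "k = 0")
  case True
  have "1 \<le> exp 1 * real n" using assms one_le_exp_iff[of 1] by (intro mult_ge1_I) auto
  then show ?thesis using True by simp
next
  case False
  then have "fact k \<le> exp 1 * real k * (real k / exp 1) ^ k" by (intro fact_le_pow) auto
  also have "\<dots> \<le> exp 1 * real n * (M / exp 1) ^ k"
    using assms by (intro mult_mono power_mono divide_right_mono) auto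
  finally show ?thesis .
qed

lemma fact_add_le: "fact (j + k) \<le> fact j * real (j + k) ^ k"
proof (induction k)
  case (Suc k)
  have "fact (j + Suc k) = real (j + Suc k) * fact (j + k)" by simp
  also have "\<dots> \<le> real (j + Suc k) * (fact j * real (j + k) ^ k)"
    by (intro mult_left_mono Suc) auto
  also have "\<dots> \<le> real (j + Suc k) * (fact j * real (j + Suc k) ^ k)"
    by (intro mult_left_mono power_mono) auto
  finally show ?case by (simp add: mult_ac)
qed simp

text \<open>Squaring allows \<open>fact j\<close> to be paired with \<open>fact (d - Suc j)\<close>;
  their product is \<open>fact (d - 1)\<close> divided by a binomial coefficient, which is at most
  \<open>2 ^ d\<close>.\<close>

lemma superfactorial_ge: "((real d / (2 * exp 1)) ^ d / real d) ^ d \<le> (\<Prod>j<d. fact j)\<^sup>2"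
proof (cases "d = 0")
  case False
  have "(\<Prod>j<d. fact j :: real)\<^sup>2 = (\<Prod>j<d. fact j) * (\<Prod>j<d. fact (d - Suc j))"
    by (simp add: power2_eq_square prod.nat_diff_reindex)
  also have "\<dots> = (\<Prod>j<d. fact j * fact (d - Suc j))" by (simp add: prod.distrib)
  also have "\<dots> \<ge> (\<Prod>j<d. (real d / (2 * exp 1)) ^ d / real d)"
  proof (intro prod_mono conjI)
    fix j assume "j \<in> {..<d}"
    then have j: "j \<le> d - 1" by auto
    have "(d - 1) choose j \<le> 2 ^ (d - 1)" by (rule binomial_le_pow2)
    also have "\<dots> \<le> 2 ^ d" by (intro power_increasing) auto
    finally have c: "real ((d - 1) choose j) \<le> 2 ^ d" by (metis of_nat_le_iff of_nat_numeral of_nat_power)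
    have "(real d / (2 * exp 1)) ^ d / real d = (real d / exp 1) ^ d / real d / 2 ^ d"
      by (simp add: power_divide power_mult_distrib)
    also have "\<dots> \<le> fact d / real d / 2 ^ d"
      by (intro divide_right_mono fact_ge_pow) auto
    also have "\<dots> = fact (d - 1) / 2 ^ d" using False by (simp add: fact_reduce[of d])
    also have "\<dots> \<le> fact (d - 1) / real ((d - 1) choose j)"
      using c j by (intro divide_left_mono mult_pos_pos) (auto simp: zero_less_binomial)
    also have "\<dots> = fact j * fact (d - 1 - j)"
      using binomial_fact_lemma[OF j, THEN arg_cong, of real] j
      by (simp add: field_simps zero_less_binomial)
    finally show "(real d / (2 * exp 1)) ^ d / real d \<le> fact j * fact (d - Suc j)" by simp
  qed simp
  finally show ?thesis by simp
qed simp

text \<open>The square is read as \<open>d\<close> arms of length \<open>d\<close> on an empty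
  rectangle. Its weight is the product of the \<open>fact j / fact (d + j)\<close>, each at least
  \<open>1 / (2 * d) ^ d\<close>, and \<open>fact (d * d)\<close> outweighs the loss.\<close>

lemma count_fillings_square_ge: "(real d / (2 * exp 1)) ^ (d * d) \<le> real (count_fillings ({..<d} \<times> {..<d}))"
proof (cases "d = 0")
  case True
  then show ?thesis by (simp add: count_fillings_empty)
next
  case False
  have shape: "arms_legs d 0 (\<lambda>_. d) (\<lambda>_. 0) = {..<d} \<times> {..<d}" by (auto simp: arms_legs_def)
  have "vandermonde d (\<lambda>i. real (d + (d - Suc i))) = vandermonde d (\<lambda>i. real (d - Suc i))"
    by (simp add: vandermonde_def)
  then have "row_weight d (\<lambda>_. d) = (\<Prod>j<d. fact j) / (\<Prod>i<d. fact (d + (d - Suc i)))"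
    by (simp only: row_weight_def vandermonde_offset)
  also have "(\<Prod>i<d. fact (d + (d - Suc i)) :: real) = (\<Prod>i<d. fact (d + i))"
    by (rule prod.nat_diff_reindex[of "\<lambda>i. fact (d + i)"])
  finally have w: "row_weight d (\<lambda>_. d) = (\<Prod>j<d. fact j / fact (d + j))" by (simp add: prod_dividef)
  have "(\<Prod>j<d. 1 / (2 * real d) ^ d) \<le> row_weight d (\<lambda>_. d)"
    unfolding w
  proof (intro prod_mono conjI)
    fix j assume j: "j \<in> {..<d}"
    have "fact (d + j) \<le> fact j * real (j + d) ^ d" using fact_add_le[of j d] by (simp add: add.commute)
    also have "\<dots> \<le> fact j * (2 * real d) ^ d" using j by (intro mult_left_mono power_mono) auto
    finally show "1 / (2 * real d) ^ d \<le> fact j / fact (d + j)"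
      using False by (simp add: divide_simps mult.commute)
  qed simp
  then have "1 / (2 * real d) ^ (d * d) \<le> row_weight d (\<lambda>_. d)"
    by (simp add: power_mult power_divide)
  moreover have "(real (d * d) / exp 1) ^ (d * d) \<le> fact (d * d)" by (rule fact_ge_pow)
  ultimately have "(real (d * d) / exp 1) ^ (d * d) * (1 / (2 * real d) ^ (d * d))
      \<le> fact (d * d) * row_weight d (\<lambda>_. d)"
    by (intro mult_mono) auto
  also have "(real (d * d) / exp 1) ^ (d * d) * (1 / (2 * real d) ^ (d * d))
      = (real (d * d) / exp 1 * (1 / (2 * real d))) ^ (d * d)"
    by (simp only: power_mult_distrib power_one_over)
  also have "real (d * d) / exp 1 * (1 / (2 * real d)) = real d / (2 * exp 1)"
    using False by simp
  also have "fact (d * d) * row_weight d (\<lambda>_. d) \<le> real (count_fillings ({..<d} \<times> {..<d}))"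
    using count_fillings_arms_legs[of d "\<lambda>_. d" 0 "\<lambda>_. 0"]
    by (simp add: shape row_weight_zero count_fillings_empty monotone_on_def)
  finally show ?thesis .
qed

section \<open>Lower bounds for diagrams with short rows and columns\<close>

text \<open>Adding a weakly decreasing \<open>r\<close> to the staircase can only widen its gaps, so
  the numerator is at least its value for \<open>r = 0\<close>, the superfactorial. In the
  denominator every shifted length is at most \<open>M\<close>, so the factorial bound with common
  base applies.\<close>

lemma row_weight_ge:
  assumes anti: "antimono_on {..<d} r" and le: "\<And>i. i < d \<Longrightarrow> real (d + r i) \<le> M"
    and n: "M \<le> real n" "1 \<le> n"
  shows "(\<Prod>j<d. fact j) / ((exp 1 * real n) ^ d * (M / exp 1) ^ (\<Sum>i<d. r i + (d - Suc i))) \<le> row_weight d r"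
proof (cases "d = 0")
  case True
  then show ?thesis by (simp add: row_weight_zero)
next
  case False
  then have "0 < M" using le[of 0] by simp
  have v: "(\<Prod>j<d. fact j) \<le> vandermonde d (\<lambda>i. real (r i + (d - Suc i)))"
    unfolding vandermonde_offset[symmetric] vandermonde_def
  proof (intro prod_mono conjI prod_nonneg)
    fix j i assume ij: "j \<in> {..<d}" "i \<in> {..<j}"
    then show "0 \<le> real (d - Suc i) - real (d - Suc j)" by auto
    have "r j \<le> r i" using anti ij by (auto simp: monotone_on_def)
    then show "real (d - Suc i) - real (d - Suc j)
        \<le> real (r i + (d - Suc i)) - real (r j + (d - Suc j))" by simp
  qed auto
  have "(\<Prod>i<d. fact (r i + (d - Suc i))) \<le> (\<Prod>i<d. exp 1 * real n * (M / exp 1) ^ (r i + (d - Suc i)))"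
  proof (intro prod_mono conjI)
    fix i assume "i \<in> {..<d}"
    then have "real (r i + (d - Suc i)) \<le> M" using le[of i] by auto
    then show "fact (r i + (d - Suc i)) \<le> exp 1 * real n * (M / exp 1) ^ (r i + (d - Suc i))"
      using n by (intro fact_le_pow_of_le) auto
  qed simp
  also have "\<dots> = (exp 1 * real n) ^ d * (M / exp 1) ^ (\<Sum>i<d. r i + (d - Suc i))"
    by (simp only: prod.distrib power_sum prod_constant card_lessThan power_mult_distrib)
  finally show ?thesis
    unfolding row_weight_def using v \<open>0 < M\<close>
    by (intro frac_le order_trans[OF _ v]) (auto intro!: prod_nonneg prod_pos)
qed

lemma card_arms_legs: "card (arms_legs d e r s) = d * e + (\<Sum>i<d. r i) + (\<Sum>j<e. s j)"
proof -
  let ?A = "SIGMA i:{..<d}. {..<e + r i}"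
  let ?L = "(\<lambda>(j, i). (i, j)) ` (SIGMA j:{..<e}. {d..<d + s j})"
  have "arms_legs d e r s = ?A \<union> ?L"
    by (auto simp: arms_legs_def image_iff)
  moreover have "?A \<inter> ?L = {}" by auto
  moreover have "card ?L = (\<Sum>j<e. s j)"
    by (subst card_image) (auto simp: inj_on_def)
  moreover have "card ?A = d * e + (\<Sum>i<d. r i)" by (simp add: sum.distrib)
  ultimately show ?thesis by (simp add: card_Un_disjoint)
qed

lemma nat_initial_segment:
  fixes A :: "nat set"
  assumes "finite A" "\<And>x y. x \<in> A \<Longrightarrow> y \<le> x \<Longrightarrow> y \<in> A"
  shows "A = {..<card A}"
proof (rule card_subset_eq)
  show "A \<subseteq> {..<card A}"
  proof
    fix x assume "x \<in> A"
    then have "card {..x} \<le> card A" using assms by (intro card_mono) auto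
    then show "x \<in> {..<card A}" by simp
  qed
qed auto

text \<open>Here \<open>d\<close> is the number of diagonal cells. A cell with both coordinates at
  least \<open>d\<close> would put \<open>(d, d)\<close> into \<open>D\<close>, and
  \<open>(d - 1, d - 1)\<close> forces the first \<open>d\<close> rows and columns to have length at
  least \<open>d\<close>, so subtracting \<open>d\<close> never truncates there.\<close>

lemma down_set_eq_arms_legs:
  assumes fin: "finite D" and down: "down_set D"
  obtains d r s where "D = arms_legs d d r s"
    "antimono_on {..<d} r" "antimono_on {..<d} s"
    "\<forall>i<d. d + r i = card {j. (i, j) \<in> D}"
    "\<forall>j<d. d + s j = card {i. (i, j) \<in> D}"
proof -
  define \<rho> where "\<rho> i = card {j. (i, j) \<in> D}" for i
  define \<kappa> where "\<kappa> j = card {i. (i, j) \<in> D}" for j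
  define d where "d = card {i. (i, i) \<in> D}"
  have dn: "(i', j') \<in> D" if "(i, j) \<in> D" "i' \<le> i" "j' \<le> j" for i j i' j'
    using down that by (auto simp: down_set_def)
  have f: "finite {j. (i, j) \<in> D}" "finite {j. (j, i) \<in> D}" "finite {i. (i, i) \<in> D}" for i
    using finite_subset[OF _ finite_imageI[OF fin, of snd], of "{j. (i, j) \<in> D}"]
      finite_subset[OF _ finite_imageI[OF fin, of fst], of "{j. (j, i) \<in> D}"]
      finite_subset[OF _ finite_imageI[OF fin, of fst], of "{i. (i, i) \<in> D}"] by force+
  have row: "{j. (i, j) \<in> D} = {..<\<rho> i}" for i
    unfolding \<rho>_def by (rule nat_initial_segment[OF f(1)]) (auto intro: dn)
  have col: "{i. (i, j) \<in> D} = {..<\<kappa> j}" for j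
    unfolding \<kappa>_def by (rule nat_initial_segment[OF f(2)]) (auto intro: dn)
  have diag: "{i. (i, i) \<in> D} = {..<d}"
    unfolding d_def by (rule nat_initial_segment[OF f(3)]) (auto intro: dn)
  have row': "(i, j) \<in> D \<longleftrightarrow> j < \<rho> i" for i j using row[of i] by auto
  have col': "(i, j) \<in> D \<longleftrightarrow> i < \<kappa> j" for i j using col[of j] by auto
  have diag': "(i, i) \<in> D \<longleftrightarrow> i < d" for i using diag by auto
  have \<rho>: "d \<le> \<rho> i" "d \<le> \<kappa> i" if "i < d" for i
    using dn[of "d - 1" "d - 1" i "d - 1"] dn[of "d - 1" "d - 1" "d - 1" i] that
      diag'[of "d - 1"] row'[of i "d - 1"] col'[of "d - 1" i] by auto
  have anti: "\<rho> j \<le> \<rho> i" "\<kappa> j \<le> \<kappa> i" if "i \<le> j" for i j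
    unfolding \<rho>_def \<kappa>_def using that by (auto intro!: card_mono f intro: dn)
  have eq: "D = arms_legs d d (\<lambda>i. \<rho> i - d) (\<lambda>j. \<kappa> j - d)"
  proof (intro set_eqI iffI)
    fix x assume "x \<in> D"
    moreover obtain i j where x: "x = (i, j)" by fastforce
    ultimately have D: "(i, j) \<in> D" by simp
    have "i < d \<or> j < d"
    proof (rule ccontr)
      assume "\<not> (i < d \<or> j < d)"
      then have "(d, d) \<in> D" using dn[OF D] by auto
      then show False using diag' by simp
    qed
    then show "x \<in> arms_legs d d (\<lambda>i. \<rho> i - d) (\<lambda>j. \<kappa> j - d)"
      using D row'[of i j] col'[of i j] \<rho>[of i] \<rho>[of j] by (auto simp: arms_legs_def x)
  next
    fix x assume "x \<in> arms_legs d d (\<lambda>i. \<rho> i - d) (\<lambda>j. \<kappa> j - d)"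
    then show "x \<in> D" using row' col' \<rho> by (auto simp: arms_legs_def)
  qed
  show thesis
    by (rule that[OF eq]) (use \<rho> anti in \<open>auto simp: monotone_on_def \<rho>_def[symmetric] \<kappa>_def[symmetric] intro!: diff_le_mono\<close>)
qed

text \<open>Two bounds for the same Durfee side \<open>d\<close>. The first counts fillings of the
  square alone and is strong for large \<open>d\<close>. In the second, about
  \<open>(n / exp 1) ^ n\<close> is divided by \<open>(n / (\<alpha> * exp 1)) ^ (n - d)\<close>,
  which leaves \<open>\<alpha> ^ n\<close> up to factors controlled by \<open>d\<close>.\<close>

lemma count_fillings_ge:
  assumes fin: "finite D" and down: "down_set D" and ne: "D \<noteq> {}" and \<alpha>: "1 \<le> \<alpha>"
    and rows: "\<And>i. real (card {j. (i, j) \<in> D}) \<le> real (card D) / \<alpha>"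
    and cols: "\<And>j. real (card {i. (i, j) \<in> D}) \<le> real (card D) / \<alpha>"
  defines "n \<equiv> card D"
  obtains d where "0 < d" "d * d \<le> n"
    "(real d / (2 * exp 1)) ^ (d * d) \<le> real (count_fillings D)"
    "\<alpha> ^ n / (\<alpha> * exp 3 * (real n)\<^sup>2) ^ d * ((real d)\<^sup>2 / (4 * exp 2 * real n)) ^ (d * d)
      \<le> real (count_fillings D)"
proof -
  obtain d r s where D: "D = arms_legs d d r s"
    and anti: "antimono_on {..<d} r" "antimono_on {..<d} s"
    and r: "\<forall>i<d. d + r i = card {j. (i, j) \<in> D}"
    and s: "\<forall>j<d. d + s j = card {i. (i, j) \<in> D}"
    using down_set_eq_arms_legs[OF fin down] by blast
  have d: "0 < d" using ne by (cases "d = 0") (auto simp: D arms_legs_def)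
  have n: "n = d * d + (\<Sum>i<d. r i) + (\<Sum>j<d. s j)" unfolding n_def D by (rule card_arms_legs)
  have n0: "1 \<le> n" using fin ne by (simp add: n_def Suc_le_eq card_gt_0_iff)
  have dn: "d * d \<le> n" using n by simp
  have "d \<le> d * d" using d by simp
  then have dn': "d \<le> n" using dn by linarith
  define M where "M = real n / \<alpha>"
  have M: "0 < M" "M \<le> real n" using n0 \<alpha> by (simp_all add: M_def divide_le_eq mult_le_cancel_left1)
  have rM: "real (d + r i) \<le> M" if "i < d" for i using rows[of i] r that by (simp add: M_def n_def)
  have sM: "real (d + s i) \<le> M" if "i < d" for i using cols[of i] s that by (simp add: M_def n_def)
  define sf :: real where "sf = (\<Prod>j<d. fact j)"
  have sf: "0 < sf" unfolding sf_def by (intro prod_pos) auto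
  define a b where "a = (\<Sum>i<d. r i + (d - Suc i))" and "b = (\<Sum>i<d. s i + (d - Suc i))"
  \<comment> \<open>The two families of offsets add up to \<open>d * (d - 1)\<close>, so the
    exponents of \<open>M / exp 1\<close> total \<open>n - d\<close>.\<close>
  have "real (a + b + d) = real n"
    unfolding a_def b_def n
    by (simp only: sum.distrib of_nat_add of_nat_sum sum_lessThan_offset of_nat_mult) (simp add: field_simps)
  then have ab: "a + b = n - d" by linarith
  define q where "q = real d / (2 * exp 1)"
  have q: "0 < q" using d by (simp add: q_def)
  have square: "q ^ (d * d) \<le> real (count_fillings ({..<d} \<times> {..<d}))"
    unfolding q_def by (rule count_fillings_square_ge)
  have "{..<d} \<times> {..<d} \<subseteq> D" by (auto simp: D arms_legs_def)
  then have "count_fillings ({..<d} \<times> {..<d}) \<le> count_fillings D"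
    by (intro count_fillings_mono fin) (auto simp: down_set_def)
  with square have 1: "q ^ (d * d) \<le> real (count_fillings D)" by linarith
  define E where "E = exp 1 * real n"
  have E: "0 < E" using n0 by (simp add: E_def)
  define A where "A = M / exp 1"
  have A: "0 < A" using M by (simp add: A_def)
  have w1: "sf / (E ^ d * A ^ a) \<le> row_weight d r"
    unfolding sf_def E_def A_def a_def by (rule row_weight_ge[OF anti(1) rM M(2) n0])
  have w2: "sf / (E ^ d * A ^ b) \<le> row_weight d s"
    unfolding sf_def E_def A_def b_def by (rule row_weight_ge[OF anti(2) sM M(2) n0])
  have f: "(\<alpha> * A) ^ n / real n ^ (d * d) \<le> fact (n - d * d)"
  proof -
    have "\<alpha> * A = real n / exp 1" using \<alpha> by (simp add: A_def M_def)
    then have "(\<alpha> * A) ^ n \<le> fact n" using fact_ge_pow[of n] by simp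
    also have "\<dots> \<le> fact (n - d * d) * real n ^ (d * d)"
      using fact_add_le[of "n - d * d" "d * d"] dn by simp
    finally show ?thesis using n0 by (simp add: divide_le_eq)
  qed
  have sf2: "(q ^ d / real d) ^ d \<le> sf\<^sup>2" unfolding sf_def q_def by (rule superfactorial_ge)
  have "q ^ (d * d) * ((\<alpha> * A) ^ n / real n ^ (d * d)) * (sf / (E ^ d * A ^ a)) * (sf / (E ^ d * A ^ b))
      \<le> real (count_fillings ({..<d} \<times> {..<d})) * fact (n - d * d) * row_weight d r * row_weight d s"
    by (intro mult_mono square f w1 w2 mult_nonneg_nonneg order_trans[OF _ w1])
      (use q A E sf \<alpha> in auto)
  also have "\<dots> \<le> real (count_fillings D)"
    using count_fillings_arms_legs[OF anti] by (simp add: D n)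
  finally have "q ^ (d * d) * ((\<alpha> * A) ^ n / real n ^ (d * d)) * (sf / (E ^ d * A ^ a)) * (sf / (E ^ d * A ^ b))
      \<le> real (count_fillings D)" .
  \<comment> \<open>All powers of \<open>A\<close> cancel except \<open>A ^ d\<close>, because
    \<open>a + b + d = n\<close>.\<close>
  moreover have "q ^ (d * d) * ((\<alpha> * A) ^ n / real n ^ (d * d)) * (sf / (E ^ d * A ^ a)) * (sf / (E ^ d * A ^ b))
     = (q / real n) ^ (d * d) * \<alpha> ^ n * (A ^ d / (E ^ d * E ^ d)) * sf\<^sup>2"
  proof -
    have "A ^ n = A ^ a * A ^ b * A ^ d" using ab dn' by (simp add: power_add[symmetric])
    then show ?thesis using A E n0 by (simp add: power_divide power_mult_distrib power2_eq_square)
  qed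
  moreover have "\<alpha> ^ n / (\<alpha> * exp 3 * (real n)\<^sup>2) ^ d * ((real d)\<^sup>2 / (4 * exp 2 * real n)) ^ (d * d)
     \<le> (q / real n) ^ (d * d) * \<alpha> ^ n * (A ^ d / (E ^ d * E ^ d)) * sf\<^sup>2"
  proof -
    \<comment> \<open>The right side is \<open>1 / (\<alpha> * exp 3 * n * d)\<close>, and
      \<open>d \<le> n\<close>; its division by \<open>d\<close> anticipates the superfactorial
      bound.\<close>
    have "1 / (\<alpha> * exp 3 * (real n)\<^sup>2) \<le> A / (E * E) / real d"
    proof -
      have "A / (E * E) / real d = 1 / (\<alpha> * exp 3 * (real n)\<^sup>2) * (real n / real d)"
        using n0 \<alpha> exp_add[of 1 "2::real"] exp_add[of 1 "1::real"] by (simp add: A_def M_def E_def power2_eq_square)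
      also have "\<dots> \<ge> 1 / (\<alpha> * exp 3 * (real n)\<^sup>2) * 1"
        using dn' d \<alpha> by (intro mult_left_mono) auto
      finally show ?thesis by simp
    qed
    then have "(1 / (\<alpha> * exp 3 * (real n)\<^sup>2)) ^ d \<le> (A / (E * E) / real d) ^ d"
      using \<alpha> by (intro power_mono) auto
    moreover have "(real d)\<^sup>2 / (4 * exp 2 * real n) = q / real n * q"
      using exp_add[of 1 "1::real"] by (simp add: q_def power2_eq_square)
    ultimately have "\<alpha> ^ n * (1 / (\<alpha> * exp 3 * (real n)\<^sup>2)) ^ d * ((real d)\<^sup>2 / (4 * exp 2 * real n)) ^ (d * d)
       \<le> \<alpha> ^ n * (A / (E * E) / real d) ^ d * (q / real n * q) ^ (d * d)"
      using \<alpha> q A by (intro mult_mono order_refl) auto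
    then have "\<alpha> ^ n / (\<alpha> * exp 3 * (real n)\<^sup>2) ^ d * ((real d)\<^sup>2 / (4 * exp 2 * real n)) ^ (d * d)
       \<le> \<alpha> ^ n * (A / (E * E) / real d) ^ d * (q / real n * q) ^ (d * d)"
      by (simp only: power_one_over times_divide_eq_right mult_1_right)
    also have "\<dots> = (q / real n) ^ (d * d) * \<alpha> ^ n * (A ^ d / (E ^ d * E ^ d)) * (q ^ d / real d) ^ d"
      by (simp add: power_divide power_mult_distrib power_mult mult_ac)
    also have "\<dots> \<le> (q / real n) ^ (d * d) * \<alpha> ^ n * (A ^ d / (E ^ d * E ^ d)) * sf\<^sup>2"
      using q A E \<alpha> by (intro mult_left_mono sf2) auto
    finally show ?thesis .
  qed
  ultimately have "\<alpha> ^ n / (\<alpha> * exp 3 * (real n)\<^sup>2) ^ d * ((real d)\<^sup>2 / (4 * exp 2 * real n)) ^ (d * d)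
     \<le> real (count_fillings D)" by linarith
  with 1 d dn that show thesis unfolding q_def by blast
qed

section \<open>Asymptotic comparison of the two bounds\<close>

text \<open>The comparison is made in logarithms, uniformly in \<open>d\<close>. For
  \<open>d \<le> \<epsilon> * sqrt n\<close> the second bound may lose \<open>g * n\<close> against
  \<open>\<alpha> ^ n\<close>, and each of its two loss terms is allotted half. For larger
  \<open>d\<close> the first bound has logarithm \<open>d^2 * ln (d / (2 * exp 1))\<close>, which
  outgrows every multiple of \<open>n\<close>.\<close>

lemma eventually_pow_le_of_bounds:
  fixes \<alpha> \<beta> :: real
  assumes "0 < \<beta>" "\<beta> < \<alpha>"
  shows "\<forall>\<^sub>F n in sequentially. \<forall>d f. 0 < d \<longrightarrow> d * d \<le> n \<longrightarrow>
    (real d / (2 * exp 1)) ^ (d * d) \<le> f \<longrightarrow>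
    \<alpha> ^ n / (\<alpha> * exp 3 * (real n)\<^sup>2) ^ d * ((real d)\<^sup>2 / (4 * exp 2 * real n)) ^ (d * d) \<le> f \<longrightarrow>
    \<beta> ^ n \<le> f"
proof -
  define g where "g = ln \<alpha> - ln \<beta>"
  have g: "0 < g" using assms by (simp add: g_def)
  \<comment> \<open>Chosen so that \<open>4 * exp 1 * \<epsilon> * n\<close>, the bound on the
    second loss term, is \<open>g / 2 * n\<close>.\<close>
  define \<epsilon> where "\<epsilon> = g / (8 * exp 1)"
  have \<epsilon>: "0 < \<epsilon>" using g by (simp add: \<epsilon>_def)
  define L where "L = ln \<alpha> + 3"
  have "\<forall>\<^sub>F n in sequentially. sqrt (real n) * (L + 2 * ln (real n)) \<le> g / 2 * real n"
    using g by real_asymp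
  moreover have "\<forall>\<^sub>F n in sequentially. 0 \<le> L + 2 * ln (real n)" by real_asymp
  \<comment> \<open>The maximum with \<open>0\<close> keeps the left side nonnegative, as
    multiplying inequalities demands, even if \<open>ln \<beta>\<close> is negative.\<close>
  moreover have "\<forall>\<^sub>F n in sequentially. max (ln \<beta>) 0 / \<epsilon>\<^sup>2 \<le> ln (\<epsilon> * sqrt (real n) / (2 * exp 1))"
    using \<epsilon> by real_asymp
  moreover have "\<forall>\<^sub>F n in sequentially. 0 < n" by (rule eventually_gt_at_top)
  ultimately show ?thesis
  proof eventually_elim
    case (elim n)
    show ?case
    proof (intro allI impI)
      fix d :: nat and f :: real
      assume d: "0 < d" "d * d \<le> n"
        and f1: "(real d / (2 * exp 1)) ^ (d * d) \<le> f"
        and f2: "\<alpha> ^ n / (\<alpha> * exp 3 * (real n)\<^sup>2) ^ d * ((real d)\<^sup>2 / (4 * exp 2 * real n)) ^ (d * d) \<le> f"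
      have f: "0 < f" using f1 d by (smt (verit) divide_pos_pos exp_gt_zero of_nat_0_less_iff zero_less_power)
      have n: "0 < real n" using elim by simp
      have "(real d)\<^sup>2 \<le> real n" using d(2) by (simp add: power2_eq_square flip: of_nat_mult)
      then have ds: "real d \<le> sqrt (real n)" by (rule real_le_rsqrt)
      have "real n * ln \<beta> \<le> ln f"
      proof (cases "real d \<le> \<epsilon> * sqrt (real n)")
        case True
        \<comment> \<open>With \<open>ln y \<le> y\<close>, the term \<open>d^2 * ln y\<close> is at
          most \<open>2 * exp 1 * sqrt n * d\<close>, which is linear in \<open>d\<close>.\<close>
        define y where "y = 2 * exp 1 * sqrt (real n) / real d"
        have y: "0 < y" using n d by (simp add: y_def)
        have y2: "(real d)\<^sup>2 / (4 * exp 2 * real n) = 1 / y\<^sup>2"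
          using n d exp_add[of 1 "1::real"] by (simp add: y_def power_divide power_mult_distrib power2_eq_square)
        have ln_y: "ln y \<le> y" using ln_le_minus_one[OF y] by simp
        have "ln (\<alpha> ^ n / (\<alpha> * exp 3 * (real n)\<^sup>2) ^ d * (1 / y\<^sup>2) ^ (d * d))
          = real n * ln \<alpha> - real d * (L + 2 * ln (real n)) - real d * real d * (2 * ln y)"
          using n y assms by (simp add: ln_mult ln_div ln_realpow L_def)
        moreover have "ln (\<alpha> ^ n / (\<alpha> * exp 3 * (real n)\<^sup>2) ^ d * (1 / y\<^sup>2) ^ (d * d)) \<le> ln f"
          using f2 n y assms f unfolding y2 by (subst ln_le_cancel_iff) auto
        moreover have "real d * (L + 2 * ln (real n)) \<le> g / 2 * real n"
          using mult_right_mono[OF ds, of "L + 2 * ln (real n)"] elim by linarith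
        moreover have "real d * real d * (2 * ln y) \<le> g / 2 * real n"
        proof -
          have "real d * real d * (2 * ln y) \<le> real d * real d * (2 * y)"
            by (intro mult_left_mono ln_y) auto
          also have "\<dots> = 4 * exp 1 * sqrt (real n) * real d" using d by (simp add: y_def)
          also have "\<dots> \<le> 4 * exp 1 * sqrt (real n) * (\<epsilon> * sqrt (real n))"
            using n by (intro mult_left_mono True) auto
          also have "\<dots> = 4 * exp 1 * \<epsilon> * (sqrt (real n) * sqrt (real n))" by (simp only: mult_ac)
          also have "\<dots> = g / 2 * real n" by (simp add: \<epsilon>_def)
          finally show ?thesis .
        qed
        ultimately have "real n * ln \<alpha> - g / 2 * real n - g / 2 * real n \<le> ln f" by linarith
        then show ?thesis by (simp add: g_def algebra_simps)
      next
        case False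
        have "real n * ln \<beta> \<le> real n * max (ln \<beta>) 0" using n by (intro mult_left_mono) auto
        also have "\<dots> = (\<epsilon> * sqrt (real n))\<^sup>2 * (max (ln \<beta>) 0 / \<epsilon>\<^sup>2)"
          using \<epsilon> n by (simp add: power_mult_distrib)
        also have "\<dots> \<le> (real d)\<^sup>2 * ln (real d / (2 * exp 1))"
        proof (intro mult_mono)
          have "ln (\<epsilon> * sqrt (real n) / (2 * exp 1)) \<le> ln (real d / (2 * exp 1))"
            using False \<epsilon> n d by (subst ln_le_cancel_iff) (auto intro!: divide_right_mono)
          then show "max (ln \<beta>) 0 / \<epsilon>\<^sup>2 \<le> ln (real d / (2 * exp 1))" using elim by linarith
          show "(\<epsilon> * sqrt (real n))\<^sup>2 \<le> (real d)\<^sup>2" using False \<epsilon> n by (intro power_mono) auto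
        qed auto
        also have "\<dots> = ln ((real d / (2 * exp 1)) ^ (d * d))"
          using d by (subst ln_realpow) (auto simp: power2_eq_square)
        also have "\<dots> \<le> ln f" using f f1 d by (subst ln_le_cancel_iff) auto
        finally show ?thesis .
      qed
      then have "ln (\<beta> ^ n) \<le> ln f" using assms by (simp add: ln_realpow)
      then show "\<beta> ^ n \<le> f" using assms f by simp
    qed
  qed
qed

section \<open>Partitions and their diagrams\<close>

lemma young_diagram_eq_Sigma: "young_diagram lam = (SIGMA i:{..<length lam}. {..<lam ! i})"
  by (auto simp: young_diagram_def)

lemma card_young_diagram: "card (young_diagram lam) = sum_list lam"
  by (simp add: young_diagram_eq_Sigma sum_list_sum_nth atLeast0LessThan)

lemma character_degree_eq: "character_degree lam = count_fillings (young_diagram lam)"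
  by (simp add: character_degree_def count_fillings_def standard_tableaux_def
      increasing_fillings_def card_young_diagram)

text \<open>The first row bounds every row, and the head of the conjugate is the number of rows,
  which bounds every column. Hence both bounds on the count hold for large \<open>n\<close>, and
  their asymptotic comparison applies.\<close>

theorem theorem4p3:
  fixes \<alpha> :: real and lam :: "nat \<Rightarrow> nat list"
  assumes "\<alpha> > 1"
    and "\<And>n. n \<ge> 1 \<Longrightarrow> is_partition (lam n) n"
    and "\<forall>\<^sub>F n in sequentially. real (hd (lam n)) \<le> real n / \<alpha>"
    and "\<forall>\<^sub>F n in sequentially. real (hd (conjugate (lam n))) \<le> real n / \<alpha>"
  shows "\<forall>\<beta>::real. 1 < \<beta> \<and> \<beta> < \<alpha> \<longrightarrow>
    (\<exists>n0. \<forall>n\<ge>n0. real (character_degree (lam n)) \<ge> \<beta> ^ n)"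
proof (intro allI impI)
  fix \<beta> :: real
  assume "1 < \<beta> \<and> \<beta> < \<alpha>"
  then have "0 < \<beta>" "\<beta> < \<alpha>" by auto
  note ev = eventually_pow_le_of_bounds[OF this]
  have "\<forall>\<^sub>F n in sequentially. real (character_degree (lam n)) \<ge> \<beta> ^ n"
    using assms(3,4) ev eventually_gt_at_top[of 0]
  proof eventually_elim
    case (elim n)
    let ?l = "lam n"
    let ?D = "young_diagram ?l"
    have part: "is_partition ?l n" using assms(2)[of n] elim by simp
    then have card: "card ?D = n" by (simp add: card_young_diagram is_partition_def)
    have fin: "finite ?D" by (simp add: young_diagram_eq_Sigma)
    have ne: "?l \<noteq> []" using part elim by (auto simp: is_partition_def)
    have anti: "?l ! j \<le> ?l ! i" if "i \<le> j" "j < length ?l" for i j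
      using part that unfolding is_partition_def
      by (cases "i = j") (auto dest: sorted_wrt_nth_less[where i = i and j = j])
    have pos: "0 < ?l ! i" if "i < length ?l" for i
      using part that unfolding is_partition_def by simp
    have hd: "hd ?l = ?l ! 0" using ne by (rule hd_conv_nth)
    \<comment> \<open>All parts are positive, so entry \<open>0\<close> of the conjugate counts
      every row.\<close>
    have "hd (conjugate ?l) = card {i. i < length ?l \<and> 0 < ?l ! i}"
      using ne pos[of 0] by (simp add: conjugate_def hd hd_map upt_conv_Cons)
    also have "{i. i < length ?l \<and> 0 < ?l ! i} = {..<length ?l}" using pos by auto
    finally have hdc: "hd (conjugate ?l) = length ?l" by simp
    have rows: "real (card {j. (i, j) \<in> ?D}) \<le> real (card ?D) / \<alpha>" for i
    proof -
      have "{j. (i, j) \<in> ?D} \<subseteq> {..<hd ?l}"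
        using anti[of 0 i] unfolding hd by (auto simp: young_diagram_def)
      then have "card {j. (i, j) \<in> ?D} \<le> hd ?l" by (metis card_lessThan card_mono finite_lessThan)
      then show ?thesis using elim unfolding card by linarith
    qed
    have cols: "real (card {i. (i, j) \<in> ?D}) \<le> real (card ?D) / \<alpha>" for j
    proof -
      have "{i. (i, j) \<in> ?D} \<subseteq> {..<length ?l}" by (auto simp: young_diagram_def)
      then have "card {i. (i, j) \<in> ?D} \<le> length ?l" by (metis card_lessThan card_mono finite_lessThan)
      then show ?thesis using elim hdc unfolding card by linarith
    qed
    have down: "down_set ?D"
      unfolding down_set_def young_diagram_def using anti by (fastforce intro: le_less_trans less_le_trans)
    have "?D \<noteq> {}" using card elim by auto
    from count_fillings_ge[OF fin down this _ rows cols] assms(1) obtain d where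
      "0 < d" "d * d \<le> n"
      "(real d / (2 * exp 1)) ^ (d * d) \<le> real (count_fillings ?D)"
      "\<alpha> ^ n / (\<alpha> * exp 3 * (real n)\<^sup>2) ^ d * ((real d)\<^sup>2 / (4 * exp 2 * real n)) ^ (d * d)
        \<le> real (count_fillings ?D)"
      unfolding card by (metis less_imp_le)
    then show ?case using elim unfolding character_degree_eq by blast
  qed
  then show "\<exists>n0. \<forall>n\<ge>n0. real (character_degree (lam n)) \<ge> \<beta> ^ n"
    by (simp add: eventually_sequentially)
qed

end
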